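(* Let $\Gamma=\Gamma(V,E)$ be a graph and let $\mathcal{M}=\{M_\alpha:\alpha\in V\}$ be a set of mutually disjoint monoids, each of which is regular. Then the graph product $\mathscr{GP}(\Gamma,\mathcal{M})$ of $\mathcal{M}$ with respect to $\Gamma$ is abundant.
   Context: Graphs: $\Gamma=\Gamma(V,E)$ is a simple undirected graph without loops, with vertex set $V$ (possibly infinite), $|V|\ge 2$, and edge set $E$ a set of $2$-element subsets of $V$; write $(\alpha,\beta)\in E$ for $\{\alpha,\beta\}\in E$. Graph product: let $1_\alpha$ be the identity of $M_\alpha$ and $X=\bigcup_{\alpha\in V}M_\alpha$. Let $X^*$ be the free monoid on $X$, with juxtaposition written $\circ$ and empty word $\epsilon$. The graph product is the monoid $\mathscr{GP}(\Gamma,\mathcal{M})=X^*/R^\sharp$, where $R^\sharp$ is the congruence on $X^*$ generated by the relations: $1_\alpha=\epsilon$ ($\alpha\in V$); $x\circ y=xy$ ($x,y\in M_\alpha$, $\alpha\in V$, with $xy$ the product in $M_\alpha$); $x\circ y=y\circ x$ ($x\in M_\alpha$, $y\in M_\beta$, $(\alpha,\beta)\in E$). A monoid $M$ is regular if for every $a\in M$ there is $b\in M$ with $a=aba$. On a monoid $M$, $a\,\mathcal{R}^*\,b$ means that for all $x,y\in M$, $xa=ya$ if and only if $xb=yb$; dually, $a\,\mathcal{L}^*\,b$ means that for all $x,y\in M$, $ax=ay$ if and only if $bx=by$. $M$ is abundant if every element of $M$ is $\mathcal{R}^*$-related to some idempotent of $M$ and $\mathcal{L}^*$-related to some idempotent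 of $M$. *)

theory Defs
  imports "HOL-Algebra.Group" "HOL-Library.Disjoint_Sets"
begin

text \<open>The condition on \<open>V\<close> in \<open>two_vertices\<close> says \<open>|V| \<ge> 2\<close> without bounding \<open>card V\<close>,
  which would exclude infinite vertex sets.\<close>

locale simple_graph =
  fixes V :: "'v set" and E :: "'v set set"
  assumes edges: "e \<in> E \<Longrightarrow> e \<subseteq> V \<and> card e = 2"
    and two_vertices: "\<exists>\<alpha>\<in>V. \<exists>\<beta>\<in>V. \<alpha> \<noteq> \<beta>"

locale regular_monoid = monoid +
  assumes regular: "a \<in> carrier G \<Longrightarrow> \<exists>b\<in>carrier G. a = a \<otimes> b \<otimes> a"

definition idempotents :: "('a, 'm) monoid_scheme \<Rightarrow> 'a set" where
  "idempotents S = {e \<in> carrier S. e \<otimes>\<^bsub>S\<^esub> e = e}"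

definition R_star :: "('a, 'm) monoid_scheme \<Rightarrow> 'a rel" where
  "R_star S = {(a, b). a \<in> carrier S \<and> b \<in> carrier S \<and>
     (\<forall>x\<in>carrier S. \<forall>y\<in>carrier S.
        x \<otimes>\<^bsub>S\<^esub> a = y \<otimes>\<^bsub>S\<^esub> a \<longleftrightarrow> x \<otimes>\<^bsub>S\<^esub> b = y \<otimes>\<^bsub>S\<^esub> b)}"

definition L_star :: "('a, 'm) monoid_scheme \<Rightarrow> 'a rel" where
  "L_star S = {(a, b). a \<in> carrier S \<and> b \<in> carrier S \<and>
     (\<forall>x\<in>carrier S. \<forall>y\<in>carrier S.
        a \<otimes>\<^bsub>S\<^esub> x = a \<otimes>\<^bsub>S\<^esub> y \<longleftrightarrow> b \<otimes>\<^bsub>S\<^esub> x = b \<otimes>\<^bsub>S\<^esub> y)}"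

locale abundant_monoid = monoid +
  assumes R_star_idempotent: "a \<in> carrier G \<Longrightarrow> \<exists>e\<in>idempotents G. (a, e) \<in> R_star G"
    and L_star_idempotent: "a \<in> carrier G \<Longrightarrow> \<exists>e\<in>idempotents G. (a, e) \<in> L_star G"

definition free_monoid :: "'a set \<Rightarrow> 'a list monoid" where
  "free_monoid X = \<lparr>carrier = lists X, mult = (@), one = []\<rparr>"

definition monoid_congruence :: "('a, 'm) monoid_scheme \<Rightarrow> 'a rel \<Rightarrow> bool" where
  "monoid_congruence S r \<longleftrightarrow> equiv (carrier S) r \<and>
     (\<forall>a b c d. (a, b) \<in> r \<longrightarrow> (c, d) \<in> r \<longrightarrow> (a \<otimes>\<^bsub>S\<^esub> c, b \<otimes>\<^bsub>S\<^esub> d) \<in> r)"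

text \<open>Meaningful only for \<open>R \<subseteq> carrier S \<times> carrier S\<close>; otherwise the intersection is over
  the empty set.\<close>

definition generated_congruence :: "('a, 'm) monoid_scheme \<Rightarrow> 'a rel \<Rightarrow> 'a rel" where
  "generated_congruence S R = \<Inter>{r. monoid_congruence S r \<and> R \<subseteq> r}"

text \<open>For a congruence \<open>r\<close>, the union in the product of the classes \<open>A\<close> and \<open>B\<close> is the single
  class of \<open>a \<otimes> b\<close>, for any representatives \<open>a \<in> A\<close> and \<open>b \<in> B\<close>.\<close>

definition quotient_monoid :: "('a, 'm) monoid_scheme \<Rightarrow> 'a rel \<Rightarrow> 'a set monoid" where
  "quotient_monoid S r =
     \<lparr>carrier = carrier S // r,
      mult = (\<lambda>A B. \<Union>a\<in>A. \<Union>b\<in>B. r `` {a \<otimes>\<^bsub>S\<^esub> b}),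
      one = r `` {\<one>\<^bsub>S\<^esub>}\<rparr>"

definition graph_product_relations ::
  "'v set \<Rightarrow> 'v set set \<Rightarrow> ('v \<Rightarrow> ('a, 'm) monoid_scheme) \<Rightarrow> 'a list rel" where
  "graph_product_relations V E M =
     {([\<one>\<^bsub>M \<alpha>\<^esub>], []) | \<alpha>. \<alpha> \<in> V} \<union>
     {([x, y], [x \<otimes>\<^bsub>M \<alpha>\<^esub> y]) | \<alpha> x y. \<alpha> \<in> V \<and> x \<in> carrier (M \<alpha>) \<and> y \<in> carrier (M \<alpha>)} \<union>
     {([x, y], [y, x]) | \<alpha> \<beta> x y. {\<alpha>, \<beta>} \<in> E \<and> x \<in> carrier (M \<alpha>) \<and> y \<in> carrier (M \<beta>)}"

definition graph_product ::
  "'v set \<Rightarrow> 'v set set \<Rightarrow> ('v \<Rightarrow> ('a, 'm) monoid_scheme) \<Rightarrow> 'a list set monoid" where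
  "graph_product V E M =
     (let F = free_monoid (\<Union>\<alpha>\<in>V. carrier (M \<alpha>))
      in quotient_monoid F (generated_congruence F (graph_product_relations V E M)))"

end

theory Submission
  imports Defs
begin

text \<open>
  Letters act from the left on reduced words modulo shuffling of adjacent vertices: a letter is
  multiplied into a letter of the same vertex if one can be shuffled to the front, and is put in
  front otherwise. This action satisfies the defining relations, so elements of the graph product
  have reduced forms unique up to shuffling, and the first letters of a word cancel under shuffling.

  An \<open>\<L>\<^sup>*\<close>-related idempotent of a reduced word \<open>a = x w\<close> is found by induction on
  length. If a letter \<open>y\<close> with \<open>y z = 1\<close> can be shuffled to the end, \<open>a = b y\<close>, and \<open>f\<close> is an
  idempotent for \<open>b\<close>, then \<open>z f y\<close> is one for \<open>a\<close>. If \<open>x\<close> commutes with all letters of \<open>w\<close>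
  and \<open>x z x = x\<close>, then \<open>f z x\<close> works, where \<open>f\<close> is an idempotent for \<open>w\<close>. In the remaining case
  the final letters of \<open>w\<close> never disappear in a product \<open>w s\<close>, and they keep its letters away from
  \<open>x\<close>, so \<open>x\<close> can be cancelled from \<open>x w s = x w t\<close>. The statement for \<open>\<R>\<^sup>*\<close> follows by passing to the
  opposite monoids and reversing words.
\<close>

section \<open>Generated congruences and quotient monoids\<close>

lemma monoid_congruence_equiv: "monoid_congruence S r \<Longrightarrow> equiv (carrier S) r"
  by (simp add: monoid_congruence_def)

lemma monoid_congruence_mult:
  "monoid_congruence S r \<Longrightarrow> (a, b) \<in> r \<Longrightarrow> (c, d) \<in> r \<Longrightarrow> (a \<otimes>\<^bsub>S\<^esub> c, b \<otimes>\<^bsub>S\<^esub> d) \<in> r"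
  unfolding monoid_congruence_def by blast

lemma generated_congruence_least:
  "monoid_congruence S r \<Longrightarrow> R \<subseteq> r \<Longrightarrow> generated_congruence S R \<subseteq> r"
  by (auto simp: generated_congruence_def)

lemma generated_congruence_superset: "R \<subseteq> generated_congruence S R"
  by (auto simp: generated_congruence_def)

text \<open>Since \<open>R\<close> lies in the square of the carrier, the full relation is among the
  intersected congruences. Hence the intersection stays inside that square, and the other closure
  properties pass to intersections.\<close>

lemma monoid_congruence_generated:
  assumes "monoid S" and "R \<subseteq> carrier S \<times> carrier S"
  shows "monoid_congruence S (generated_congruence S R)"
proof -
  let ?C = "generated_congruence S R"
  have "monoid_congruence S (carrier S \<times> carrier S)"
    by (auto simp: monoid_congruence_def intro!: equivI refl_onI symI transI monoid.m_closed[OF assms(1)])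
  then have sub: "?C \<subseteq> carrier S \<times> carrier S"
    using assms(2) by (rule generated_congruence_least)
  have "equiv (carrier S) ?C"
  proof (rule equivI)
    show "refl_on (carrier S) ?C"
      using sub by (auto simp: generated_congruence_def monoid_congruence_def equiv_def refl_on_def)
    show "sym ?C"
      by (auto simp: generated_congruence_def monoid_congruence_def equiv_def intro!: symI dest: symD)
    show "trans ?C"
      by (rule transI)
        (auto simp: generated_congruence_def monoid_congruence_def equiv_def dest: transD)
  qed (use sub in auto)
  then show ?thesis
    by (auto simp: monoid_congruence_def generated_congruence_def)
qed

text \<open>Products of representatives all fall into one class, so the union that defines the
  product runs over a nonempty constant family.\<close>

lemma quotient_monoid_mult:
  assumes "monoid_congruence S r" and "a \<in> carrier S" and "b \<in> carrier S"
  shows "r `` {a} \<otimes>\<^bsub>quotient_monoid S r\<^esub> r `` {b} = r `` {a \<otimes>\<^bsub>S\<^esub> b}"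
proof -
  note eq = monoid_congruence_equiv[OF assms(1)]
  have "r `` {a' \<otimes>\<^bsub>S\<^esub> b'} = r `` {a \<otimes>\<^bsub>S\<^esub> b}" if "a' \<in> r `` {a}" "b' \<in> r `` {b}" for a' b'
    using that monoid_congruence_mult[OF assms(1)] equiv_class_eq[OF eq] by blast
  moreover have "a \<in> r `` {a}" "b \<in> r `` {b}"
    using equiv_class_self[OF eq] assms by auto
  ultimately have *: "\<And>a' b'. a' \<in> r `` {a} \<Longrightarrow> b' \<in> r `` {b} \<Longrightarrow>
      r `` {a' \<otimes>\<^bsub>S\<^esub> b'} = r `` {a \<otimes>\<^bsub>S\<^esub> b}" and "r `` {a} \<noteq> {}" "r `` {b} \<noteq> {}"
    by blast+
  have "(\<Union>a'\<in>r `` {a}. \<Union>b'\<in>r `` {b}. r `` {a' \<otimes>\<^bsub>S\<^esub> b'}) =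
      (\<Union>a'\<in>r `` {a}. \<Union>b'\<in>r `` {b}. r `` {a \<otimes>\<^bsub>S\<^esub> b})"
    by (intro SUP_cong HOL.refl *)
  also have "\<dots> = r `` {a \<otimes>\<^bsub>S\<^esub> b}"
    using \<open>r `` {a} \<noteq> {}\<close> \<open>r `` {b} \<noteq> {}\<close> by (simp only: UN_constant if_False)
  finally show ?thesis
    by (simp add: quotient_monoid_def)
qed

lemma monoid_quotient_monoid:
  assumes "monoid S" and "monoid_congruence S r"
  shows "monoid (quotient_monoid S r)"
proof -
  interpret monoid S by fact
  let ?Q = "quotient_monoid S r"
  have car: "carrier ?Q = (\<lambda>a. r `` {a}) ` carrier S"
    by (auto simp: quotient_monoid_def quotient_def)
  have one: "\<one>\<^bsub>?Q\<^esub> = r `` {\<one>\<^bsub>S\<^esub>}"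
    by (simp add: quotient_monoid_def)
  show ?thesis
    by unfold_locales (auto simp: car one quotient_monoid_mult[OF assms(2)] m_assoc)
qed

lemma monoid_free_monoid: "monoid (free_monoid X)"
  by unfold_locales (auto simp: free_monoid_def)

section \<open>Letters, their vertices and their products\<close>

locale graph_of_monoids =
  fixes V :: "'v set" and E :: "'v set set" and M :: "'v \<Rightarrow> ('a, 'm) monoid_scheme"
  assumes edges: "e \<in> E \<Longrightarrow> e \<subseteq> V \<and> card e = 2"
    and monoids: "\<alpha> \<in> V \<Longrightarrow> monoid (M \<alpha>)"
    and disjoint: "disjoint_family_on (\<lambda>\<alpha>. carrier (M \<alpha>)) V"
begin

definition letters :: "'a set" where
  "letters = (\<Union>\<alpha>\<in>V. carrier (M \<alpha>))"

text \<open>Words are lists of bare elements; disjointness of the carriers makes the vertex of a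
  letter recoverable from the element alone.\<close>

definition vertex :: "'a \<Rightarrow> 'v" where
  "vertex x = (THE \<alpha>. \<alpha> \<in> V \<and> x \<in> carrier (M \<alpha>))"

text \<open>Meaningful only for letters \<open>x\<close> and \<open>y\<close> of the same vertex.\<close>

definition lmult :: "'a \<Rightarrow> 'a \<Rightarrow> 'a" (infixl "\<cdot>" 70) where
  "x \<cdot> y = x \<otimes>\<^bsub>M (vertex x)\<^esub> y"

definition trivial :: "'a \<Rightarrow> bool" where
  "trivial x \<longleftrightarrow> x = \<one>\<^bsub>M (vertex x)\<^esub>"

definition adj :: "'v \<Rightarrow> 'v \<Rightarrow> bool" where
  "adj \<alpha> \<beta> \<longleftrightarrow> {\<alpha>, \<beta>} \<in> E"

lemma adj_commute: "adj \<alpha> \<beta> \<longleftrightarrow> adj \<beta> \<alpha>"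
  by (simp add: adj_def insert_commute)

lemma adj_sym: "adj \<alpha> \<beta> \<Longrightarrow> adj \<beta> \<alpha>"
  using adj_commute by blast

lemma adj_irrefl [simp]: "\<not> adj \<alpha> \<alpha>"
  using edges[of "{\<alpha>}"] by (auto simp: adj_def)

lemma vertex_eq: "\<alpha> \<in> V \<Longrightarrow> x \<in> carrier (M \<alpha>) \<Longrightarrow> vertex x = \<alpha>"
  using disjoint unfolding vertex_def disjoint_family_on_def by (intro the_equality) blast+

lemma letter_vertex: "x \<in> letters \<Longrightarrow> vertex x \<in> V \<and> x \<in> carrier (M (vertex x))"
  using vertex_eq by (auto simp: letters_def)

lemma lmult_letter:
  assumes "x \<in> letters" "y \<in> letters" "vertex x = vertex y"
  shows "x \<cdot> y \<in> letters" and "vertex (x \<cdot> y) = vertex y"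
proof -
  have "x \<cdot> y \<in> carrier (M (vertex y))" "vertex y \<in> V"
    using assms letter_vertex monoid.m_closed[OF monoids] by (metis lmult_def)+
  then show "x \<cdot> y \<in> letters" and "vertex (x \<cdot> y) = vertex y"
    using vertex_eq by (auto simp: letters_def)
qed

lemma lmult_assoc:
  assumes "x \<in> letters" "y \<in> letters" "z \<in> letters" "vertex x = vertex y" "vertex y = vertex z"
  shows "x \<cdot> y \<cdot> z = x \<cdot> (y \<cdot> z)"
  using assms lmult_letter[OF assms(1,2,4)] letter_vertex monoid.m_assoc[OF monoids]
  by (metis lmult_def)

lemma trivial_lmult:
  assumes "trivial x" "x \<in> letters" "y \<in> letters" "vertex x = vertex y"
  shows "x \<cdot> y = y" and "y \<cdot> x = y"
  using assms letter_vertex monoid.l_one[OF monoids] monoid.r_one[OF monoids]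
  by (metis lmult_def trivial_def)+

lemma trivial_one:
  assumes "\<alpha> \<in> V"
  shows "\<one>\<^bsub>M \<alpha>\<^esub> \<in> letters" "vertex \<one>\<^bsub>M \<alpha>\<^esub> = \<alpha>" "trivial \<one>\<^bsub>M \<alpha>\<^esub>"
proof -
  have "\<one>\<^bsub>M \<alpha>\<^esub> \<in> carrier (M \<alpha>)"
    using assms monoids monoid.one_closed by blast
  then show "\<one>\<^bsub>M \<alpha>\<^esub> \<in> letters" "vertex \<one>\<^bsub>M \<alpha>\<^esub> = \<alpha>" "trivial \<one>\<^bsub>M \<alpha>\<^esub>"
    using assms vertex_eq by (auto simp: letters_def trivial_def)
qed

subsection \<open>Shuffling\<close>

text \<open>The equivalence generated by exchanging neighbouring letters of adjacent vertices.
  \<open>swap\<close> acts at the head only and \<open>cons\<close> carries it further in; symmetry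
  comes from that of \<open>adj\<close>.\<close>

inductive shuffle :: "'a list \<Rightarrow> 'a list \<Rightarrow> bool" (infix "\<approx>" 50) where
  refl [simp, intro]: "p \<approx> p"
| trans [trans]: "p \<approx> q \<Longrightarrow> q \<approx> r \<Longrightarrow> p \<approx> r"
| cons: "p \<approx> q \<Longrightarrow> x # p \<approx> x # q"
| swap: "adj (vertex x) (vertex y) \<Longrightarrow> x # y # p \<approx> y # x # p"

lemma shuffle_sym: "p \<approx> q \<Longrightarrow> q \<approx> p"
proof (induction rule: shuffle.induct)
  case (trans p q r)
  then show ?case using shuffle.trans by blast
next
  case (swap x y p)
  then show ?case using adj_sym shuffle.swap by blast
qed (auto intro: shuffle.cons)

lemma shuffle_move:
  "\<forall>z\<in>set u. adj (vertex z) (vertex x) \<Longrightarrow> u @ x # p \<approx> x # u @ p"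
proof (induction u)
  case (Cons z u)
  then have "z # u @ x # p \<approx> z # x # u @ p" by (auto intro: shuffle.cons)
  also have "\<dots> \<approx> x # z # u @ p" using Cons by (auto intro: shuffle.swap)
  finally show ?case by simp
qed auto

text \<open>Expresses that a letter of vertex \<open>\<alpha>\<close> can be shuffled to the head:
  everything before the first such letter is adjacent to \<open>\<alpha>\<close>.\<close>

primrec front :: "'v \<Rightarrow> 'a list \<Rightarrow> bool" where
  "front \<alpha> [] \<longleftrightarrow> False"
| "front \<alpha> (x # p) \<longleftrightarrow> vertex x = \<alpha> \<or> adj (vertex x) \<alpha> \<and> front \<alpha> p"

primrec remove_at :: "'v \<Rightarrow> 'a list \<Rightarrow> 'a list" where
  "remove_at \<alpha> [] = []"
| "remove_at \<alpha> (x # p) = (if vertex x = \<alpha> then p else x # remove_at \<alpha> p)"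

lemma front_shuffle: "p \<approx> q \<Longrightarrow> front \<alpha> p = front \<alpha> q"
  by (induction rule: shuffle.induct) (auto simp: adj_commute)

text \<open>As \<open>adj\<close> is irreflexive, letters of the same vertex never pass each other.
  So the first letter of each vertex is a shuffle invariant, and so is, up to shuffling, the word
  left after deleting it.\<close>

lemma find_shuffle:
  "p \<approx> q \<Longrightarrow> find (\<lambda>x. vertex x = \<alpha>) p = find (\<lambda>x. vertex x = \<alpha>) q"
  by (induction rule: shuffle.induct) auto

lemma remove_at_shuffle: "p \<approx> q \<Longrightarrow> remove_at \<alpha> p \<approx> remove_at \<alpha> q"
proof (induction rule: shuffle.induct)
  case (trans p q r)
  then show ?case using shuffle.trans by blast
qed (auto intro: shuffle.cons shuffle.swap)

text \<open>Both invariants are read off at the vertex of \<open>x\<close>: the first letter there,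
  and the word without it.\<close>

lemma shuffle_Cons_cancel:
  assumes "x # p \<approx> y # q" "vertex x = vertex y"
  shows "x = y" and "p \<approx> q"
  using find_shuffle[OF assms(1), of "vertex x"] remove_at_shuffle[OF assms(1), of "vertex x"] assms(2)
  by auto

lemma front_vertex: "front \<alpha> p \<Longrightarrow> \<alpha> \<in> vertex ` set p"
  by (induction p) auto

lemma front_decomp:
  "front \<alpha> p \<Longrightarrow> \<exists>u y t. p = u @ y # t \<and> vertex y = \<alpha> \<and> (\<forall>z\<in>set u. adj (vertex z) \<alpha>)"
proof (induction p)
  case (Cons x p)
  show ?case
  proof (cases "vertex x = \<alpha>")
    case True
    then show ?thesis by (intro exI[of _ "[]"]) auto
  next
    case False
    with Cons obtain u y t
      where "p = u @ y # t" "vertex y = \<alpha>" "\<forall>z\<in>set u. adj (vertex z) \<alpha>" "adj (vertex x) \<alpha>"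
      by auto
    then show ?thesis by (intro exI[of _ "x # u"]) auto
  qed
qed simp

subsection \<open>The action of letters on reduced words\<close>

text \<open>The normal form of graph products: no letter is trivial, and none can be shuffled next
  to a later letter of its own vertex.\<close>

primrec reduced :: "'a list \<Rightarrow> bool" where
  "reduced [] \<longleftrightarrow> True"
| "reduced (x # p) \<longleftrightarrow> x \<in> letters \<and> \<not> trivial x \<and> \<not> front (vertex x) p \<and> reduced p"

text \<open>Dropping trivial letters lets a product that becomes an identity be treated like any
  other product, and lets an identity stand for an absent letter.\<close>

definition scons :: "'a \<Rightarrow> 'a list \<Rightarrow> 'a list" where
  "scons x p = (if trivial x then p else x # p)"

text \<open>Meant for words in which a letter of the vertex of \<open>x\<close> can reach the head.
  \<open>ins\<close> ensures this, so the value at the empty word is only a default.\<close>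

primrec merge :: "'a \<Rightarrow> 'a list \<Rightarrow> 'a list" where
  "merge x [] = [x]"
| "merge x (y # p) = (if vertex y = vertex x then scons (x \<cdot> y) p else y # merge x p)"

definition ins :: "'a \<Rightarrow> 'a list \<Rightarrow> 'a list" where
  "ins x p = (if front (vertex x) p then merge x p else scons x p)"

definition act :: "'a list \<Rightarrow> 'a list \<Rightarrow> 'a list" where
  "act u p = foldr ins u p"

lemma reduced_letters: "reduced p \<Longrightarrow> set p \<subseteq> letters"
  by (induction p) auto

lemma scons_shuffle: "p \<approx> q \<Longrightarrow> scons x p \<approx> scons x q"
  by (simp add: scons_def shuffle.cons)

lemma scons_swap: "adj (vertex x) (vertex y) \<Longrightarrow> scons x (scons y p) \<approx> scons y (scons x p)"
  by (auto simp: scons_def shuffle.swap)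

lemma front_scons:
  "front \<alpha> (scons x p) \<Longrightarrow> vertex x = \<alpha> \<or> adj (vertex x) \<alpha> \<and> front \<alpha> p \<or> trivial x \<and> front \<alpha> p"
  by (auto simp: scons_def split: if_splits)

lemma reduced_scons:
  "x \<in> letters \<Longrightarrow> \<not> front (vertex x) p \<Longrightarrow> reduced p \<Longrightarrow> reduced (scons x p)"
  by (simp add: scons_def)

lemma merge_decomp:
  assumes "\<forall>z\<in>set u. adj (vertex z) (vertex x)" "vertex y = vertex x"
  shows "merge x (u @ y # t) = u @ scons (x \<cdot> y) t"
  using assms by (induction u) auto

text \<open>Merging changes or deletes only a letter of the vertex of \<open>x\<close>. Such a
  letter commutes with \<open>\<beta>\<close>, so its removal unblocks no letter of vertex
  \<open>\<beta>\<close>.\<close>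

lemma front_merge:
  assumes "front (vertex x) p" "x \<in> letters" "set p \<subseteq> letters" "adj (vertex x) \<beta>"
    and "front \<beta> (merge x p)"
  shows "front \<beta> p"
  using assms
proof (induction p)
  case (Cons y p)
  show ?case
  proof (cases "vertex y = vertex x")
    case True
    then have "vertex (x \<cdot> y) = vertex x" using lmult_letter Cons by auto
    then show ?thesis using Cons True by (auto dest!: front_scons)
  qed (use Cons in auto)
qed simp

text \<open>The letters skipped by \<open>merge\<close> have vertices adjacent to that of
  \<open>x\<close>, so \<open>front_merge\<close> shows that none of them gets a new partner to
  merge with.\<close>

lemma reduced_merge:
  assumes "front (vertex x) p" "x \<in> letters" "reduced p"
  shows "reduced (merge x p)"
  using assms
proof (induction p)
  case (Cons y p)
  show ?case
  proof (cases "vertex y = vertex x")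
    case True
    then have "vertex (x \<cdot> y) = vertex x" "x \<cdot> y \<in> letters" using lmult_letter Cons by auto
    then show ?thesis using Cons True by (auto intro: reduced_scons)
  next
    case False
    then show ?thesis
      using Cons front_merge[of x p "vertex y"] reduced_letters adj_sym by auto
  qed
qed simp

lemma reduced_ins: "x \<in> letters \<Longrightarrow> reduced p \<Longrightarrow> reduced (ins x p)"
  by (simp add: ins_def reduced_merge reduced_scons)

lemma reduced_act: "set u \<subseteq> letters \<Longrightarrow> reduced p \<Longrightarrow> reduced (act u p)"
  unfolding act_def by (induction u) (auto intro: reduced_ins)

lemma ins_decomp:
  assumes "front (vertex x) p" "x \<in> letters" "set p \<subseteq> letters"
  obtains y t where "y \<in> letters" "vertex y = vertex x" "p \<approx> y # t" "ins x p \<approx> scons (x \<cdot> y) t"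
proof -
  obtain u y t where d: "p = u @ y # t" "vertex y = vertex x" "\<forall>z\<in>set u. adj (vertex z) (vertex x)"
    using front_decomp[OF assms(1)] by blast
  have y: "y \<in> letters" using d assms by auto
  have "vertex (x \<cdot> y) = vertex x" using lmult_letter d y assms by auto
  then have "u @ scons (x \<cdot> y) t \<approx> scons (x \<cdot> y) (u @ t)"
    using shuffle_move[of u "x \<cdot> y"] d by (auto simp: scons_def)
  moreover have "ins x p = u @ scons (x \<cdot> y) t"
    using assms(1) d by (simp add: ins_def merge_decomp)
  moreover have "p \<approx> y # u @ t"
    using shuffle_move[of u y] d by auto
  ultimately show thesis using that d y by metis
qed

text \<open>Whether a merge takes place is a shuffle invariant. If it does, the factorization of the
  word into the merging letter and the rest is unique up to shuffling.\<close>

lemma ins_shuffle: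
  assumes "p \<approx> q" "x \<in> letters" "set p \<subseteq> letters" "set q \<subseteq> letters"
  shows "ins x p \<approx> ins x q"
proof (cases "front (vertex x) p")
  case True
  then obtain y t where p: "vertex y = vertex x" "p \<approx> y # t" "ins x p \<approx> scons (x \<cdot> y) t"
    using ins_decomp assms by metis
  have "front (vertex x) q" using True front_shuffle[OF assms(1)] by simp
  then obtain z r where q: "vertex z = vertex x" "q \<approx> z # r" "ins x q \<approx> scons (x \<cdot> z) r"
    using ins_decomp assms by metis
  have "y # t \<approx> z # r"
    using p q assms(1) shuffle_sym shuffle.trans by meson
  then have "y = z" "t \<approx> r"
    using shuffle_Cons_cancel p q by metis+
  then have "scons (x \<cdot> y) t \<approx> scons (x \<cdot> z) r"
    by (simp add: scons_shuffle)
  then show ?thesis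
    using p q shuffle_sym shuffle.trans by meson
next
  case False
  then show ?thesis
    using front_shuffle[OF assms(1)] scons_shuffle[OF assms(1)] by (simp add: ins_def)
qed

lemma act_shuffle:
  assumes "p \<approx> q" "set u \<subseteq> letters" "reduced p" "reduced q"
  shows "act u p \<approx> act u q"
  using assms(2)
proof (induction u)
  case (Cons x u)
  then have "set (act u p) \<subseteq> letters" "set (act u q) \<subseteq> letters"
    using reduced_act assms reduced_letters by auto
  then show ?case
    using Cons ins_shuffle[of "act u p" "act u q" x] by (simp add: act_def)
qed (simp add: act_def assms)

text \<open>In the coordinates \<open>z\<close> and \<open>q\<close> the action is plain left
  multiplication on \<open>z\<close>, with a trivial \<open>z\<close> for an absent letter. This
  reduces the defining relations to identities in the vertex monoids.\<close>

lemma ins_scons: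
  assumes "p \<approx> scons z q" "reduced p" "reduced q" "\<not> front (vertex z) q"
    and "z \<in> letters" "x \<in> letters" "vertex x = vertex z"
  shows "ins x p \<approx> scons (x \<cdot> z) q"
proof -
  have "ins x p \<approx> ins x (scons z q)"
    using assms by (intro ins_shuffle reduced_letters reduced_scons) auto
  also have "ins x (scons z q) = scons (x \<cdot> z) q"
    using assms by (auto simp: scons_def ins_def trivial_lmult)
  finally show ?thesis .
qed

text \<open>The letter \<open>y\<close> commutes with all that follows it, so it was blocking
  nothing and its deletion brings no letter to the front.\<close>

lemma reduced_delete:
  assumes "reduced (u @ y # t)"
    and "\<forall>c\<in>set t. adj (vertex c) (vertex y)"
  shows "reduced (u @ t)"
proof -
  have "front \<beta> (w @ y # t)" if "front \<beta> (w @ t)" for \<beta> w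
    using that
  proof (induction w)
    case Nil
    then have "adj (vertex y) \<beta>" using front_vertex[of \<beta> t] assms(2) adj_sym by auto
    with Nil show ?case by simp
  qed auto
  then show ?thesis
    using assms(1) by (induction u) auto
qed

text \<open>Removing \<open>y\<close> can only free letters whose vertex is not adjacent to that of
  \<open>y\<close>, and no letter of \<open>u\<close> has such a vertex.\<close>

lemma reduced_extract:
  assumes "reduced (u @ y # t)" and "\<forall>c\<in>set u. adj (vertex c) (vertex y)"
  shows "reduced (u @ t)" "\<not> front (vertex y) (u @ t)"
proof -
  have "front \<beta> (w @ y # t)" if "front \<beta> (w @ t)" "adj (vertex y) \<beta>" for \<beta> w
    using that by (induction w) auto
  then show "reduced (u @ t)"
    using assms by (induction u) (auto simp: adj_commute)
  have "\<not> front (vertex y) t" using assms(1) by (induction u) auto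
  then show "\<not> front (vertex y) (u @ t)"
    using assms(2) by (induction u) auto
qed

lemma scons_decomp:
  assumes "reduced p" "\<alpha> \<in> V"
  obtains z q where "p \<approx> scons z q" "z \<in> letters" "vertex z = \<alpha>" "reduced q" "\<not> front \<alpha> q"
proof (cases "front \<alpha> p")
  case True
  then obtain u y t where d: "p = u @ y # t" "vertex y = \<alpha>" "\<forall>z\<in>set u. adj (vertex z) \<alpha>"
    using front_decomp by blast
  have "\<not> trivial y" "y \<in> letters"
    using assms(1) unfolding d by (induction u) auto
  then show ?thesis
    using that[of y "u @ t"] d shuffle_move[of u y t] reduced_extract[of u y t] assms
    by (auto simp: scons_def)
next
  case False
  then show ?thesis
    \<comment> \<open>No letter of vertex \<open>\<alpha>\<close> can reach the head, so the
      identity of \<open>M \<alpha>\<close> takes the place of \<open>z\<close>.\<close>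
    using that[of "\<one>\<^bsub>M \<alpha>\<^esub>" p] trivial_one[OF assms(2)] assms(1) by (auto simp: scons_def)
qed

text \<open>Together with \<open>ins_lmult\<close> and \<open>ins_commute\<close>, this shows that
  the action respects the three kinds of defining relations up to shuffling.\<close>

lemma ins_one:
  assumes "reduced p" "\<alpha> \<in> V"
  shows "ins \<one>\<^bsub>M \<alpha>\<^esub> p \<approx> p"
proof -
  obtain z q where z: "p \<approx> scons z q" "z \<in> letters" "vertex z = \<alpha>" "reduced q" "\<not> front \<alpha> q"
    using scons_decomp assms by blast
  then show ?thesis
    using ins_scons[of p z q "\<one>\<^bsub>M \<alpha>\<^esub>"] trivial_one[OF assms(2)] assms(1)
    by (auto simp: trivial_lmult intro: shuffle.trans shuffle_sym)
qed

lemma ins_lmult: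
  assumes "reduced p" "x \<in> letters" "y \<in> letters" "vertex x = vertex y"
  shows "ins x (ins y p) \<approx> ins (x \<cdot> y) p"
proof -
  obtain z q where z: "p \<approx> scons z q" "z \<in> letters" "vertex z = vertex y"
      "reduced q" "\<not> front (vertex y) q"
    using scons_decomp assms letter_vertex by metis
  have "ins y p \<approx> scons (y \<cdot> z) q"
    using z assms by (intro ins_scons) auto
  then have "ins x (ins y p) \<approx> scons (x \<cdot> (y \<cdot> z)) q"
    using z assms by (intro ins_scons) (auto simp: lmult_letter intro: reduced_ins)
  moreover have "ins (x \<cdot> y) p \<approx> scons (x \<cdot> y \<cdot> z) q"
    using z assms by (intro ins_scons) (auto simp: lmult_letter)
  moreover have "x \<cdot> y \<cdot> z = x \<cdot> (y \<cdot> z)"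
    using z assms by (intro lmult_assoc) auto
  ultimately show ?thesis
    using shuffle.trans[OF _ shuffle_sym] by metis
qed

text \<open>Splitting off the coordinates \<open>z\<close> and \<open>w\<close> at both vertices,
  the two letters act on different coordinates, and these can be exchanged.\<close>

lemma ins_commute:
  assumes "reduced p" "x \<in> letters" "y \<in> letters" "adj (vertex x) (vertex y)"
  shows "ins x (ins y p) \<approx> ins y (ins x p)"
proof -
  note xy = assms(4) adj_sym[OF assms(4)]
  have ne: "vertex x \<noteq> vertex y" using assms(4) by auto
  obtain z q where z: "p \<approx> scons z q" "z \<in> letters" "vertex z = vertex x"
      "reduced q" "\<not> front (vertex x) q"
    using scons_decomp assms letter_vertex by metis
  obtain w r where w: "q \<approx> scons w r" "w \<in> letters" "vertex w = vertex y"
      "reduced r" "\<not> front (vertex y) r"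
    using scons_decomp z assms letter_vertex by metis
  \<comment> \<open>A letter of this vertex in front of \<open>r\<close> could also pass
    \<open>w\<close>, and would then be in front of \<open>q\<close>.\<close>
  have fr: "\<not> front (vertex x) r"
    using z(5) front_shuffle[OF w(1)] w(3) xy by (auto simp: scons_def split: if_splits)
  have nx: "\<not> front (vertex x) (scons a r)" and rx: "reduced (scons a r)"
    if "a \<in> letters" "vertex a = vertex y" for a
    using that fr w ne front_scons[of "vertex x" a r] by (auto intro: reduced_scons)
  have ny: "\<not> front (vertex y) (scons a r)" and ry: "reduced (scons a r)"
    if "a \<in> letters" "vertex a = vertex x" for a
    using that fr w ne front_scons[of "vertex y" a r] by (auto intro: reduced_scons)
  have p1: "p \<approx> scons z (scons w r)"
    using z(1) scons_shuffle[OF w(1)] by (rule shuffle.trans)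
  then have p2: "p \<approx> scons w (scons z r)"
    using scons_swap[of z w r] z w xy by (auto intro: shuffle.trans)
  have yw: "y \<cdot> w \<in> letters" "vertex (y \<cdot> w) = vertex y" and xz: "x \<cdot> z \<in> letters" "vertex (x \<cdot> z) = vertex x"
    using z w assms lmult_letter by auto
  have "ins y p \<approx> scons (y \<cdot> w) (scons z r)"
    using p2 z w assms ny ry by (intro ins_scons) auto
  also have "\<dots> \<approx> scons z (scons (y \<cdot> w) r)"
    using yw z xy by (intro scons_swap) auto
  finally have y: "ins x (ins y p) \<approx> scons (x \<cdot> z) (scons (y \<cdot> w) r)"
    using z w assms nx rx yw by (intro ins_scons) (auto intro: reduced_ins)
  have "ins x p \<approx> scons (x \<cdot> z) (scons w r)"
    using p1 z w assms nx rx by (intro ins_scons) auto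
  also have "\<dots> \<approx> scons w (scons (x \<cdot> z) r)"
    using xz w xy by (intro scons_swap) auto
  finally have x: "ins y (ins x p) \<approx> scons (y \<cdot> w) (scons (x \<cdot> z) r)"
    using z w assms ny ry xz by (intro ins_scons) (auto intro: reduced_ins)
  have "scons (x \<cdot> z) (scons (y \<cdot> w) r) \<approx> scons (y \<cdot> w) (scons (x \<cdot> z) r)"
    using xz yw xy by (intro scons_swap) auto
  then show ?thesis
    using x y shuffle_sym shuffle.trans by meson
qed

subsection \<open>Words and their classes\<close>

abbreviation "words \<equiv> free_monoid letters"

abbreviation "relations \<equiv> graph_product_relations V E M"

abbreviation "C \<equiv> generated_congruence words relations"

lemma carrier_words [simp]: "carrier words = lists letters"
  and mult_words [simp]: "u \<otimes>\<^bsub>words\<^esub> w = u @ w"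
  and one_words [simp]: "\<one>\<^bsub>words\<^esub> = []"
  by (simp_all add: free_monoid_def)

lemma edge_vertices: "{\<alpha>, \<beta>} \<in> E \<Longrightarrow> \<alpha> \<in> V \<and> \<beta> \<in> V"
  using edges by blast

lemma relations_cases:
  assumes "(u, w) \<in> relations"
  obtains \<alpha> where "\<alpha> \<in> V" "u = [\<one>\<^bsub>M \<alpha>\<^esub>]" "w = []"
  | x y where "x \<in> letters" "y \<in> letters" "vertex x = vertex y" "u = [x, y]" "w = [x \<cdot> y]"
  | x y where "x \<in> letters" "y \<in> letters" "adj (vertex x) (vertex y)" "u = [x, y]" "w = [y, x]"
proof -
  have l: "x \<in> letters" if "x \<in> carrier (M \<alpha>)" "\<alpha> \<in> V" for x \<alpha>
    using that by (auto simp: letters_def)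
  show thesis
    using assms unfolding graph_product_relations_def
  proof (elim UnE CollectE exE conjE)
    fix \<alpha> x y
    assume "(u, w) = ([x, y], [x \<otimes>\<^bsub>M \<alpha>\<^esub> y])" "\<alpha> \<in> V" "x \<in> carrier (M \<alpha>)" "y \<in> carrier (M \<alpha>)"
    then show thesis using that(2)[of x y] l vertex_eq by (simp add: lmult_def)
  next
    fix \<alpha> \<beta> x y
    assume "(u, w) = ([x, y], [y, x])" "{\<alpha>, \<beta>} \<in> E" "x \<in> carrier (M \<alpha>)" "y \<in> carrier (M \<beta>)"
    then show thesis
      using that(3)[of x y] l vertex_eq[of \<alpha> x] vertex_eq[of \<beta> y] edge_vertices[of \<alpha> \<beta>]
      by (simp add: adj_def)
  qed (use that(1) in auto)
qed

lemma relations_intros: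
  "\<alpha> \<in> V \<Longrightarrow> ([\<one>\<^bsub>M \<alpha>\<^esub>], []) \<in> relations"
  "x \<in> letters \<Longrightarrow> y \<in> letters \<Longrightarrow> vertex x = vertex y \<Longrightarrow> ([x, y], [x \<cdot> y]) \<in> relations"
  "x \<in> letters \<Longrightarrow> y \<in> letters \<Longrightarrow> adj (vertex x) (vertex y) \<Longrightarrow> ([x, y], [y, x]) \<in> relations"
  using letter_vertex[of x] letter_vertex[of y]
  by (auto simp: graph_product_relations_def lmult_def adj_def)

lemma relations_words: "relations \<subseteq> lists letters \<times> lists letters"
  by (auto elim!: relations_cases simp: trivial_one lmult_letter)

lemma congruence_C: "monoid_congruence words C"
  using monoid_congruence_generated[OF monoid_free_monoid, of relations letters] relations_words
  by simp

definition cls :: "'a list \<Rightarrow> 'a list set" where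
  "cls u = C `` {u}"

lemma cls_eq_iff: "u \<in> lists letters \<Longrightarrow> w \<in> lists letters \<Longrightarrow> cls u = cls w \<longleftrightarrow> (u, w) \<in> C"
  using eq_equiv_class_iff[OF monoid_congruence_equiv[OF congruence_C]] by (simp add: cls_def)

lemma cls_append_cong:
  assumes "cls u = cls u'" "cls w = cls w'"
    and "u \<in> lists letters" "w \<in> lists letters" "u' \<in> lists letters" "w' \<in> lists letters"
  shows "cls (u @ w) = cls (u' @ w')"
  using assms monoid_congruence_mult[OF congruence_C, of u u' w w'] by (simp add: cls_eq_iff)

lemma cls_rel: "(u, w) \<in> relations \<Longrightarrow> cls u = cls w"
  using relations_words generated_congruence_superset[of relations words] cls_eq_iff by blast

lemma cls_lmult:
  "x \<in> letters \<Longrightarrow> y \<in> letters \<Longrightarrow> vertex x = vertex y \<Longrightarrow> cls [x, y] = cls [x \<cdot> y]"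
  by (intro cls_rel relations_intros)

lemma cls_trivial: "x \<in> letters \<Longrightarrow> trivial x \<Longrightarrow> cls [x] = cls []"
  using cls_rel[OF relations_intros(1)[of "vertex x"]] letter_vertex[of x] by (simp add: trivial_def)

lemma cls_adj:
  "x \<in> letters \<Longrightarrow> y \<in> letters \<Longrightarrow> adj (vertex x) (vertex y) \<Longrightarrow> cls [x, y] = cls [y, x]"
  by (intro cls_rel relations_intros)

lemma cls_Cons_cong:
  "cls u = cls w \<Longrightarrow> x \<in> letters \<Longrightarrow> u \<in> lists letters \<Longrightarrow> w \<in> lists letters \<Longrightarrow> cls (x # u) = cls (x # w)"
  using cls_append_cong[of "[x]" "[x]" u w] by simp

lemma cls_shuffle: "p \<approx> q \<Longrightarrow> p \<in> lists letters \<Longrightarrow> cls p = cls q \<and> q \<in> lists letters"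
proof (induction rule: shuffle.induct)
  case (cons p q x)
  then show ?case using cls_Cons_cong[of p q x] by simp
next
  case (swap x y p)
  then show ?case using cls_append_cong[of "[x, y]" "[y, x]" p p] cls_adj[of x y] by auto
qed auto

lemma cls_scons: "x \<in> letters \<Longrightarrow> p \<in> lists letters \<Longrightarrow> cls (scons x p) = cls (x # p)"
  using cls_append_cong[of "[x]" "[]" p p] cls_trivial by (auto simp: scons_def)

text \<open>The action is multiplication in the graph product, carried out on representatives.
  Acting on the empty word therefore gives every element a reduced representative.\<close>

lemma cls_ins:
  assumes "x \<in> letters" "reduced p"
  shows "cls (ins x p) = cls (x # p)"
proof -
  have p: "p \<in> lists letters" using assms reduced_letters by auto
  have i: "ins x p \<in> lists letters" using assms reduced_ins reduced_letters by blast
  show ?thesis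
  proof (cases "front (vertex x) p")
    case True
    then obtain y t where y: "y \<in> letters" "vertex y = vertex x" "p \<approx> y # t" "ins x p \<approx> scons (x \<cdot> y) t"
      using ins_decomp assms reduced_letters by metis
    have t: "t \<in> lists letters" "cls p = cls (y # t)" using cls_shuffle[OF y(3) p] by auto
    have "cls (ins x p) = cls (scons (x \<cdot> y) t)" using cls_shuffle[OF y(4) i] by simp
    also have "\<dots> = cls ([x \<cdot> y] @ t)" using y assms t by (simp add: cls_scons lmult_letter)
    also have "\<dots> = cls ([x, y] @ t)"
      using y assms t by (intro cls_append_cong cls_lmult[symmetric]) (auto simp: lmult_letter)
    also have "\<dots> = cls (x # p)" using y assms t p cls_Cons_cong[of p "y # t" x] by simp
    finally show ?thesis .
  qed (use assms p in \<open>simp add: ins_def cls_scons\<close>)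
qed

lemma cls_act:
  "u \<in> lists letters \<Longrightarrow> reduced p \<Longrightarrow> cls (act u p) = cls (u @ p)"
proof (induction u)
  case (Cons x u)
  have r: "reduced (act u p)" using Cons reduced_act by auto
  then have "cls (act (x # u) p) = cls (x # act u p)"
    using Cons cls_ins[of x "act u p"] by (simp add: act_def)
  also have "\<dots> = cls (x # u @ p)"
    using Cons r reduced_letters by (intro cls_Cons_cong) auto
  finally show ?case by simp
qed (simp add: act_def)

lemma act_append: "act (u @ w) p = act u (act w p)"
  by (simp add: act_def)

text \<open>Pairs of words that act alike up to shuffling form a congruence containing the defining
  relations, hence containing \<open>C\<close>. This makes reduced forms unique up to
  shuffling.\<close>

lemma act_cls:
  assumes "cls u = cls w" "u \<in> lists letters" "w \<in> lists letters" "reduced p"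
  shows "act u p \<approx> act w p"
proof -
  define r where "r = {(u, w). u \<in> lists letters \<and> w \<in> lists letters \<and> (\<forall>p. reduced p \<longrightarrow> act u p \<approx> act w p)}"
  have "monoid_congruence words r"
    unfolding monoid_congruence_def
  proof (intro conjI allI impI)
    show "equiv (carrier words) r"
      by (intro equivI refl_onI symI transI) (unfold r_def, auto, (meson shuffle_sym shuffle.trans)+)
    fix a b c d
    assume r: "(a, b) \<in> r" "(c, d) \<in> r"
    have "act (a @ c) p \<approx> act (b @ d) p" if p: "reduced p" for p
    proof -
      \<comment> \<open>Congruence in the right factor needs that the action itself preserves
        shuffling.\<close>
      have "act a (act c p) \<approx> act a (act d p)"
        using r p by (intro act_shuffle) (auto simp: r_def intro!: reduced_act)
      also have "\<dots> \<approx> act b (act d p)"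
        using r p reduced_act[of d p] by (simp add: r_def lists_eq_set)
      finally show ?thesis by (simp add: act_append)
    qed
    then show "(a \<otimes>\<^bsub>words\<^esub> c, b \<otimes>\<^bsub>words\<^esub> d) \<in> r"
      using r by (auto simp: r_def)
  qed
  moreover have "relations \<subseteq> r"
    by (auto simp: r_def act_def trivial_one lmult_letter elim!: relations_cases
        intro: ins_one ins_lmult ins_commute)
  ultimately have "C \<subseteq> r" by (rule generated_congruence_least)
  then show ?thesis using assms cls_eq_iff by (auto simp: r_def)
qed

lemma cls_context:
  assumes "cls u = cls w" "u \<in> lists letters" "w \<in> lists letters" "p \<in> lists letters" "q \<in> lists letters"
  shows "cls (p @ u @ q) = cls (p @ w @ q)"
  using assms by (intro cls_append_cong) auto

lemma cls_move:
  assumes "\<forall>c\<in>set u. adj (vertex c) (vertex x)" "x \<in> letters" "u \<in> lists letters" "p \<in> lists letters"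
  shows "cls (u @ x # p) = cls (x # u @ p)"
  using cls_shuffle[OF shuffle_move[of u x p]] assms by auto

lemma cls_act_Nil: "u \<in> lists letters \<Longrightarrow> cls (act u []) = cls u"
  using cls_act[of u "[]"] by simp

subsection \<open>Abundance\<close>

definition right_invertible :: "'a \<Rightarrow> bool" where
  "right_invertible y \<longleftrightarrow> (\<exists>z\<in>letters. vertex z = vertex y \<and> trivial (y \<cdot> z))"

text \<open>No letter that can be shuffled to the end is right invertible.\<close>

definition rigid :: "'a list \<Rightarrow> bool" where
  "rigid p \<longleftrightarrow> (\<forall>u y t. p = u @ y # t \<longrightarrow> (\<forall>c\<in>set t. adj (vertex c) (vertex y)) \<longrightarrow>
     \<not> right_invertible y)"

lemma rigid_Cons: "rigid (x # p) \<Longrightarrow> rigid p"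
  unfolding rigid_def by (metis append_Cons)

text \<open>If \<open>y\<close> merges, it is not right invertible, so the product is not trivial. A
  letter of the vertex of \<open>y\<close> thus remains in every case, and other letters must pass
  it to reach the front.\<close>

lemma front_ins:
  assumes "front \<beta> (ins y q)" "set q \<subseteq> letters" "y \<in> letters" "\<not> trivial y"
    and "front (vertex y) q \<Longrightarrow> \<not> right_invertible y"
  shows "\<beta> = vertex y \<or> adj \<beta> (vertex y) \<and> front \<beta> q"
proof (cases "front (vertex y) q")
  case True
  then obtain u z t where d: "q = u @ z # t" "vertex z = vertex y" "\<forall>c\<in>set u. adj (vertex c) (vertex y)"
    using front_decomp by blast
  have "\<not> trivial (y \<cdot> z)"
    using assms True d by (auto simp: right_invertible_def)
  then have i: "ins y q = u @ (y \<cdot> z) # t"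
    using True d by (simp add: ins_def merge_decomp scons_def)
  have v: "vertex (y \<cdot> z) = vertex y"
    using lmult_letter assms d by auto
  have "front \<beta> (u @ (y \<cdot> z) # t) \<Longrightarrow> \<beta> = vertex y \<or> adj \<beta> (vertex y) \<and> front \<beta> (u @ z # t)"
    using d(2,3) v by (induction u) (auto simp: adj_commute)
  then show ?thesis using assms(1) i d by simp
next
  case False
  then show ?thesis using assms by (auto simp: ins_def scons_def adj_commute)
qed

text \<open>In the product of a rigid word \<open>w\<close> with \<open>s\<close>, a front letter
  comes either from the front of \<open>w\<close> or from \<open>s\<close>, and in the latter case
  it has passed every letter of \<open>w\<close>.\<close>

lemma front_act:
  assumes "reduced w" "rigid w" "reduced s" "front \<beta> (act w s)"
  shows "front \<beta> w \<or> (\<forall>c\<in>set w. adj \<beta> (vertex c)) \<and> front \<beta> s"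
  using assms
proof (induction w arbitrary: \<beta>)
  case (Cons y w)
  have r: "reduced (act w s)"
    using Cons.prems reduced_letters by (intro reduced_act) auto
  have IH: "front \<gamma> (act w s) \<Longrightarrow> front \<gamma> w \<or> (\<forall>c\<in>set w. adj \<gamma> (vertex c)) \<and> front \<gamma> s" for \<gamma>
    using Cons rigid_Cons by auto
  \<comment> \<open>A merge partner of \<open>y\<close> cannot come from the front of
    \<open>w\<close>, as \<open>y # w\<close> is reduced. So it has passed all of \<open>w\<close>;
    then \<open>y\<close> can be shuffled to the end, and rigidity applies.\<close>
  have "\<not> right_invertible y" if "front (vertex y) (act w s)"
  proof -
    have "\<forall>c\<in>set w. adj (vertex c) (vertex y)"
      using IH[OF that] Cons.prems by (auto simp: adj_commute)
    then show ?thesis using Cons.prems(2) unfolding rigid_def by blast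
  qed
  then have "\<beta> = vertex y \<or> adj \<beta> (vertex y) \<and> front \<beta> (act w s)"
    using Cons.prems r reduced_letters by (intro front_ins) (auto simp: act_def)
  then show ?case using IH[of \<beta>] by (auto simp: adj_commute)
qed (simp add: act_def)

text \<open>The letter \<open>x\<close> does not merge when it acts on the normal forms of
  \<open>w @ s\<close> and \<open>w @ t\<close>, so shuffle cancellation removes it.\<close>

lemma rigid_cancel:
  assumes "reduced (x # w)" "rigid (x # w)" "\<exists>c\<in>set w. \<not> adj (vertex c) (vertex x)"
    and "cls (x # w @ s) = cls (x # w @ t)" "s \<in> lists letters" "t \<in> lists letters"
  shows "cls (w @ s) = cls (w @ t)"
proof -
  have w: "w \<in> lists letters" "x \<in> letters" using assms reduced_letters by auto
  have *: "act (x # w @ p) [] = x # act (w @ p) []" if p: "p \<in> lists letters" for p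
  proof -
    \<comment> \<open>Of the alternatives in \<open>front_act\<close>, the first fails as
      \<open>x # w\<close> is reduced, the second because of the letter of \<open>w\<close> not
      adjacent to \<open>x\<close>.\<close>
    have "\<not> front (vertex x) (act w (act p []))"
      using front_act[of w "act p []" "vertex x"] assms(1,3) rigid_Cons[OF assms(2)] p
      by (auto simp: adj_commute reduced_act subset_iff)
    then show ?thesis using assms(1) by (simp add: act_def ins_def scons_def)
  qed
  have "x # act (w @ s) [] \<approx> x # act (w @ t) []"
    using act_cls[OF assms(4), of "[]"] assms w by (simp add: *)
  then have "act (w @ s) [] \<approx> act (w @ t) []"
    by (rule shuffle_Cons_cancel) simp
  moreover have "act (w @ s) [] \<in> lists letters"
    using assms w reduced_letters[OF reduced_act[of "w @ s" "[]"]] by auto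
  ultimately have "cls (act (w @ s) []) = cls (act (w @ t) [])"
    using cls_shuffle by blast
  then show ?thesis using assms w by (simp add: cls_act_Nil)
qed

section \<open>Construction of L*-related idempotents\<close>

text \<open>States on representatives that the class of \<open>e\<close> is an idempotent L*-related
  to the class of \<open>a\<close>.\<close>

definition L_idempotent :: "'a list \<Rightarrow> 'a list \<Rightarrow> bool" where
  "L_idempotent a e \<longleftrightarrow> e \<in> lists letters \<and> cls (e @ e) = cls e \<and>
     (\<forall>s\<in>lists letters. \<forall>t\<in>lists letters. cls (a @ s) = cls (a @ t) \<longleftrightarrow> cls (e @ s) = cls (e @ t))"

text \<open>The factor \<open>y z\<close> inside the square of \<open>z f y\<close> vanishes, which
  gives idempotency. Left multiplication by \<open>y\<close> undoes that by \<open>z\<close>, so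
  \<open>z f y\<close> has the same cancellation behaviour as \<open>f y\<close>.\<close>

lemma L_idempotent_right_invertible:
  assumes "L_idempotent a f" "a \<in> lists letters" "y \<in> letters" "z \<in> letters"
    and "cls [y, z] = cls []"
  shows "L_idempotent (a @ [y]) (z # f @ [y])"
proof -
  have f: "f \<in> lists letters" "cls (f @ f) = cls f" using assms by (auto simp: L_idempotent_def)
  have "cls ((z # f @ [y]) @ z # f @ [y]) = cls (z # f @ f @ [y])"
    using cls_context[OF assms(5), of "z # f" "f @ [y]"] f assms by simp
  also have "\<dots> = cls (z # f @ [y])"
    using cls_context[OF f(2), of "[z]" "[y]"] f assms by simp
  finally have idem: "cls ((z # f @ [y]) @ z # f @ [y]) = cls (z # f @ [y])" .
  have "cls (a @ y # s) = cls (a @ y # t) \<longleftrightarrow> cls (z # f @ y # s) = cls (z # f @ y # t)"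
    if s: "s \<in> lists letters" "t \<in> lists letters" for s t
  proof -
    have a: "cls (a @ y # s) = cls (a @ y # t) \<longleftrightarrow> cls (f @ y # s) = cls (f @ y # t)"
      using assms s by (auto simp: L_idempotent_def)
    have c: "cls (y # z # f @ y # p) = cls (f @ y # p)" if "p \<in> lists letters" for p
      using cls_context[OF assms(5), of "[]" "f @ y # p"] that f assms by simp
    have "cls (y # z # f @ y # s) = cls (y # z # f @ y # t)" if "cls (z # f @ y # s) = cls (z # f @ y # t)"
      using s f assms by (intro cls_Cons_cong[OF that]) auto
    moreover have "cls (z # f @ y # s) = cls (z # f @ y # t)" if "cls (f @ y # s) = cls (f @ y # t)"
      using s f assms by (intro cls_Cons_cong[OF that]) auto
    ultimately show ?thesis using a c[OF s(1)] c[OF s(2)] by metis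
  qed
  then show ?thesis using f idem assms by (simp add: L_idempotent_def)
qed

end

locale graph_of_regular_monoids = graph_of_monoids V E M
  for V :: "'v set" and E :: "'v set set" and M :: "'v \<Rightarrow> ('a, 'm) monoid_scheme" +
  assumes regular: "\<alpha> \<in> V \<Longrightarrow> regular_monoid (M \<alpha>)"
begin

lemma letter_regular:
  assumes "x \<in> letters"
  obtains z where "z \<in> letters" "vertex z = vertex x" "x \<cdot> z \<cdot> x = x"
proof -
  note x = letter_vertex[OF assms]
  then obtain z where z: "z \<in> carrier (M (vertex x))" "x = x \<otimes>\<^bsub>M (vertex x)\<^esub> z \<otimes>\<^bsub>M (vertex x)\<^esub> x"
    using regular_monoid.regular[OF regular] by blast
  then have "z \<in> letters" "vertex z = vertex x"
    using x vertex_eq by (auto simp: letters_def)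
  moreover from this have "vertex (x \<cdot> z) = vertex x" using lmult_letter assms by simp
  ultimately show thesis using that z by (simp add: lmult_def)
qed

text \<open>From \<open>x z x = x\<close> it follows that \<open>z x\<close> is an idempotent with
  \<open>x (z x) = x\<close>. Its letter commutes with those of \<open>e\<close> and of
  \<open>w\<close>, so the idempotents for \<open>w\<close> and for \<open>x\<close> can be
  multiplied.\<close>

lemma L_idempotent_commuting:
  assumes "L_idempotent w e" "x \<in> letters" "w \<in> lists letters"
    and w: "\<forall>c\<in>set w. adj (vertex c) (vertex x)"
    and e: "\<forall>c\<in>set e. adj (vertex c) (vertex x)"
  shows "\<exists>f\<in>letters. vertex f = vertex x \<and> L_idempotent (x # w) (e @ [f])"
proof -
  obtain z where z: "z \<in> letters" "vertex z = vertex x" "x \<cdot> z \<cdot> x = x"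
    using letter_regular assms by blast
  let ?f = "z \<cdot> x"
  have f: "?f \<in> letters" "vertex ?f = vertex x" using lmult_letter z assms by auto
  have xf: "x \<cdot> ?f = x" using lmult_assoc[of x z x] z assms by simp
  have "?f \<cdot> ?f = z \<cdot> (x \<cdot> ?f)" using f z assms by (intro lmult_assoc) auto
  then have ff: "?f \<cdot> ?f = ?f" using xf by simp
  have el: "e \<in> lists letters" "cls (e @ e) = cls e" using assms by (auto simp: L_idempotent_def)
  have fold: "cls (a # b # p) = cls ((a \<cdot> b) # p)"
    if "a \<in> letters" "b \<in> letters" "vertex a = vertex b" "p \<in> lists letters" for a b p
    using cls_append_cong[OF cls_lmult[of a b], of p p] that lmult_letter by simp
  have "cls ((e @ [?f]) @ e @ [?f]) = cls (e @ e @ [?f, ?f])"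
    using cls_append_cong[of e e "?f # e @ [?f]" "e @ [?f, ?f]"] cls_move[of e ?f "[?f]"] e f el by simp
  also have "\<dots> = cls (e @ [?f, ?f])"
    using cls_append_cong[OF el(2), of "[?f, ?f]" "[?f, ?f]"] el f by simp
  also have "\<dots> = cls (e @ [?f])"
    using cls_append_cong[of e e "[?f, ?f]" "[?f]"] cls_lmult[of ?f ?f] ff el f by simp
  finally have idem: "cls ((e @ [?f]) @ e @ [?f]) = cls (e @ [?f])" .
  have "cls (x # w @ s) = cls (x # w @ t) \<longleftrightarrow> cls (e @ ?f # s) = cls (e @ ?f # t)"
    if s: "s \<in> lists letters" "t \<in> lists letters" for s t
  proof -
    \<comment> \<open>The property of \<open>e\<close> is applied to the suffixes
      \<open>?f # s\<close> and \<open>?f # t\<close>.\<close>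
    have "cls (e @ ?f # s) = cls (e @ ?f # t) \<longleftrightarrow> cls (w @ ?f # s) = cls (w @ ?f # t)"
      using assms(1) s f by (auto simp: L_idempotent_def)
    also have "\<dots> \<longleftrightarrow> cls (?f # w @ s) = cls (?f # w @ t)"
      using cls_move[of w ?f] w f s assms by simp
    also have "\<dots> \<longleftrightarrow> cls (x # w @ s) = cls (x # w @ t)"
    proof
      assume "cls (?f # w @ s) = cls (?f # w @ t)"
      then have "cls (x # ?f # w @ s) = cls (x # ?f # w @ t)"
        by (rule cls_Cons_cong) (use f assms s in auto)
      then show "cls (x # w @ s) = cls (x # w @ t)"
        using f assms s xf by (simp add: fold)
    next
      assume "cls (x # w @ s) = cls (x # w @ t)"
      then have "cls (z # x # w @ s) = cls (z # x # w @ t)"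
        by (rule cls_Cons_cong) (use z assms s in auto)
      then show "cls (?f # w @ s) = cls (?f # w @ t)"
        using z assms s by (simp add: fold)
    qed
    finally show ?thesis by simp
  qed
  then have "L_idempotent (x # w) (e @ [?f])"
    using idem el f by (simp add: L_idempotent_def)
  then show ?thesis using f by blast
qed

text \<open>The inclusion of vertices is carried through the induction because the commuting case
  needs the letters of \<open>e\<close> to commute with \<open>x\<close>. The induction is on
  length, since the letter removed in the case of a word that is not rigid may lie inside
  it.\<close>

lemma reduced_L_idempotent:
  "reduced a \<Longrightarrow> \<exists>e. vertex ` set e \<subseteq> vertex ` set a \<and> L_idempotent a e"
proof (induction a rule: length_induct)
  case (1 a)
  then have a: "a \<in> lists letters" using reduced_letters[of a] by auto
  show ?case
  proof (cases "rigid a")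
    case False
    then obtain u y t where d: "a = u @ y # t" "\<forall>c\<in>set t. adj (vertex c) (vertex y)" "right_invertible y"
      unfolding rigid_def by blast
    then obtain z where z: "z \<in> letters" "vertex z = vertex y" "trivial (y \<cdot> z)"
      unfolding right_invertible_def by blast
    have l: "y \<in> letters" "u \<in> lists letters" "t \<in> lists letters" using a d by auto
    obtain f where f: "vertex ` set f \<subseteq> vertex ` set (u @ t)" "L_idempotent (u @ t) f"
      using 1(1)[rule_format, of "u @ t"] 1(2) d reduced_delete[of u y t] by auto
    have "cls [y, z] = cls []"
      using cls_lmult[of y z] cls_trivial[of "y \<cdot> z"] z l lmult_letter by simp
    then have e: "L_idempotent ((u @ t) @ [y]) (z # f @ [y])"
      using f z l by (intro L_idempotent_right_invertible) auto
    \<comment> \<open>The letter \<open>y\<close> is shuffled back from the end to its place in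
      \<open>a\<close>.\<close>
    have "cls (u @ t @ y # p) = cls (a @ p)" if p: "p \<in> lists letters" for p
      using cls_append_cong[of u u "t @ y # p" "y # t @ p"] cls_move[of t y p] p l d by simp
    then have "L_idempotent a (z # f @ [y])"
      using e by (simp add: L_idempotent_def)
    moreover have "vertex ` set (z # f @ [y]) \<subseteq> vertex ` set a"
      using f z d by auto
    ultimately show ?thesis by blast
  next
    case True
    show ?thesis
    proof (cases a)
      case Nil
      then show ?thesis by (auto simp: L_idempotent_def intro!: exI[of _ "[]"])
    next
      case (Cons x w)
      then obtain e where e: "vertex ` set e \<subseteq> vertex ` set w" "L_idempotent w e"
        using 1(1)[rule_format, of w] 1(2) by auto
      show ?thesis
      proof (cases "\<forall>c\<in>set w. adj (vertex c) (vertex x)")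
        case com: True
        then have "\<forall>c\<in>set e. adj (vertex c) (vertex x)"
          using e(1) by (auto simp: image_subset_iff image_iff)
        then obtain f where "vertex f = vertex x" "L_idempotent a (e @ [f])"
          using L_idempotent_commuting[of w e x] com e a Cons by auto
        moreover from this e Cons have "vertex ` set (e @ [f]) \<subseteq> vertex ` set a"
          by (simp add: subset_insertI2)
        ultimately show ?thesis by blast
      next
        case False
        \<comment> \<open>By left cancellation of \<open>x\<close>, the idempotent for
          \<open>w\<close> serves for \<open>a\<close> as well.\<close>
        have "cls (a @ s) = cls (a @ t) \<longleftrightarrow> cls (w @ s) = cls (w @ t)"
          if st: "s \<in> lists letters" "t \<in> lists letters" for s t
        proof
          assume "cls (a @ s) = cls (a @ t)"
          then show "cls (w @ s) = cls (w @ t)"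
            using 1(2) True False Cons st by (intro rigid_cancel[of x w s t]) simp_all
        next
          assume "cls (w @ s) = cls (w @ t)"
          then show "cls (a @ s) = cls (a @ t)"
            using a Cons st cls_Cons_cong[of "w @ s" "w @ t" x] by simp
        qed
        then have "L_idempotent a e" using e by (simp add: L_idempotent_def)
        moreover have "vertex ` set e \<subseteq> vertex ` set a"
          using e(1) Cons by (simp add: subset_insertI2)
        ultimately show ?thesis by blast
      qed
    qed
  qed
qed

text \<open>Acting on the empty word replaces \<open>a\<close> by a reduced representative of its
  class.\<close>

lemma ex_L_idempotent:
  assumes "a \<in> lists letters"
  obtains e where "L_idempotent a e"
proof -
  have r: "reduced (act a [])" using assms reduced_act[of a "[]"] by auto
  then obtain e where e: "L_idempotent (act a []) e" using reduced_L_idempotent by blast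
  have "cls (act a [] @ s) = cls (a @ s)" if "s \<in> lists letters" for s
    using cls_append_cong[OF cls_act_Nil, of a s s] assms that reduced_letters[OF r] by auto
  then show thesis using that[of e] e by (simp add: L_idempotent_def)
qed

end

section \<open>Opposite monoids and reversal of words\<close>

definition opposite :: "('a, 'm) monoid_scheme \<Rightarrow> 'a monoid" where
  "opposite S = \<lparr>carrier = carrier S, mult = (\<lambda>x y. y \<otimes>\<^bsub>S\<^esub> x), one = \<one>\<^bsub>S\<^esub>\<rparr>"

lemma opposite_simps [simp]:
  "carrier (opposite S) = carrier S" "x \<otimes>\<^bsub>opposite S\<^esub> y = y \<otimes>\<^bsub>S\<^esub> x" "\<one>\<^bsub>opposite S\<^esub> = \<one>\<^bsub>S\<^esub>"
  by (simp_all add: opposite_def)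

lemma regular_monoid_opposite:
  assumes "regular_monoid S"
  shows "regular_monoid (opposite S)"
proof -
  interpret regular_monoid S by fact
  show ?thesis
  proof unfold_locales
    fix a assume "a \<in> carrier (opposite S)"
    then show "\<exists>b\<in>carrier (opposite S). a = a \<otimes>\<^bsub>opposite S\<^esub> b \<otimes>\<^bsub>opposite S\<^esub> a"
      using regular[of a] by (auto simp: m_assoc)
  qed (auto simp: m_assoc)
qed

text \<open>Taking opposites forgets the extension fields of the records, so the relations are
  compared rather than the families of monoids.\<close>

lemma graph_product_relations_opposite:
  "graph_product_relations V E (\<lambda>\<alpha>. opposite (opposite (M \<alpha>))) = graph_product_relations V E M"
  by (simp add: graph_product_relations_def)

lemma rev_graph_product_relations:
  assumes "(u, w) \<in> graph_product_relations V E M"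
  shows "(rev u, rev w) \<in> graph_product_relations V E (\<lambda>\<alpha>. opposite (M \<alpha>))"
  using assms unfolding graph_product_relations_def
proof (elim UnE CollectE exE conjE)
  fix \<alpha> \<beta> x y
  assume "(u, w) = ([x, y], [y, x])" "{\<alpha>, \<beta>} \<in> E" "x \<in> carrier (M \<alpha>)" "y \<in> carrier (M \<beta>)"
  \<comment> \<open>After reversal the letter of \<open>\<beta>\<close> comes first, so the edge is
    read in the other order.\<close>
  moreover from this have "{\<beta>, \<alpha>} \<in> E" by (simp add: insert_commute)
  ultimately show "(rev u, rev w) \<in> {([\<one>\<^bsub>opposite (M \<alpha>)\<^esub>], []) |\<alpha>. \<alpha> \<in> V} \<union>
     {([x, y], [x \<otimes>\<^bsub>opposite (M \<alpha>)\<^esub> y]) |\<alpha> x y.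
        \<alpha> \<in> V \<and> x \<in> carrier (opposite (M \<alpha>)) \<and> y \<in> carrier (opposite (M \<alpha>))} \<union>
     {([x, y], [y, x]) |\<alpha> \<beta> x y.
        {\<alpha>, \<beta>} \<in> E \<and> x \<in> carrier (opposite (M \<alpha>)) \<and> y \<in> carrier (opposite (M \<beta>))}"
    by auto
qed auto

text \<open>The preimage under reversal of the congruence generated by \<open>R'\<close> is again a
  congruence and contains \<open>R\<close>, so it contains the congruence generated by
  \<open>R\<close>.\<close>

lemma rev_generated_congruence:
  assumes cong: "monoid_congruence (free_monoid X) (generated_congruence (free_monoid X) R')"
    and R: "\<And>u w. (u, w) \<in> R \<Longrightarrow> (rev u, rev w) \<in> R'"
    and "(u, w) \<in> generated_congruence (free_monoid X) R"
  shows "(rev u, rev w) \<in> generated_congruence (free_monoid X) R'"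
proof -
  let ?C = "generated_congruence (free_monoid X) R'"
  let ?r = "{(u, w). (rev u, rev w) \<in> ?C}"
  have eq: "equiv (lists X) ?C"
    using monoid_congruence_equiv[OF cong] by (simp add: free_monoid_def)
  have sub: "u \<in> lists X \<and> w \<in> lists X" if "(rev u, rev w) \<in> ?C" for u w
    using that eq unfolding equiv_def by fastforce
  have "equiv (lists X) ?r"
  proof (rule equivI)
    show "?r \<subseteq> lists X \<times> lists X" using sub by blast
    show "refl_on (lists X) ?r" using eq sub by (auto simp: equiv_def refl_on_def)
    show "sym ?r" using eq by (auto simp: equiv_def intro!: symI dest: symD)
    show "trans ?r" using eq by (auto simp: equiv_def intro!: transI dest: transD)
  qed
  moreover have "(rev (a @ c), rev (b @ d)) \<in> ?C" if "(rev a, rev b) \<in> ?C" "(rev c, rev d) \<in> ?C" for a b c d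
    \<comment> \<open>Reversal exchanges the two factors, hence the swapped order of the
      facts.\<close>
    using monoid_congruence_mult[OF cong that(2,1)] by (simp add: free_monoid_def)
  ultimately have "monoid_congruence (free_monoid X) ?r"
    by (simp add: monoid_congruence_def free_monoid_def)
  moreover have "R \<subseteq> ?r"
    using R generated_congruence_superset[of R' "free_monoid X"] by auto
  ultimately have "generated_congruence (free_monoid X) R \<subseteq> ?r"
    by (rule generated_congruence_least)
  then show ?thesis using assms(3) by auto
qed

context graph_of_regular_monoids
begin

lemma graph_of_regular_monoids_opposite:
  "graph_of_regular_monoids V E (\<lambda>\<alpha>. opposite (M \<alpha>))"
proof (intro graph_of_regular_monoids.intro graph_of_monoids.intro
    graph_of_regular_monoids_axioms.intro)
  show "Group.monoid (opposite (M \<alpha>))" if "\<alpha> \<in> V" for \<alpha>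
    using regular_monoid_opposite[OF regular[OF that]] by (simp add: regular_monoid_def)
qed (use edges disjoint regular regular_monoid_opposite[OF regular] in simp_all)

text \<open>Reversal induces an anti-isomorphism onto the graph product of the opposite monoids. The
  converse direction reverses a second time, passing to double opposites.\<close>

lemma cls_rev_iff:
  assumes "u \<in> lists letters" "w \<in> lists letters"
  shows "graph_of_monoids.cls V E (\<lambda>\<alpha>. opposite (M \<alpha>)) (rev u) =
    graph_of_monoids.cls V E (\<lambda>\<alpha>. opposite (M \<alpha>)) (rev w) \<longleftrightarrow> cls u = cls w"
proof -
  interpret opp: graph_of_regular_monoids V E "\<lambda>\<alpha>. opposite (M \<alpha>)"
    by (rule graph_of_regular_monoids_opposite)
  have l: "opp.letters = letters"
    by (simp add: opp.letters_def letters_def)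
  have "(u, w) \<in> C \<Longrightarrow> (rev u, rev w) \<in> opp.C"
    unfolding l using opp.congruence_C[unfolded l] rev_graph_product_relations
    by (rule rev_generated_congruence)
  moreover have "(rev (rev u), rev (rev w)) \<in> C" if "(rev u, rev w) \<in> opp.C"
    using congruence_C _ that[unfolded l]
  proof (rule rev_generated_congruence)
    show "(rev a, rev b) \<in> relations" if "(a, b) \<in> opp.relations" for a b
      using rev_graph_product_relations[OF that] by (simp only: graph_product_relations_opposite)
  qed
  ultimately show ?thesis
    using assms cls_eq_iff[of u w] opp.cls_eq_iff[of "rev u" "rev w", unfolded l]
    by (auto simp: l in_lists_conv_set)
qed

text \<open>Reversal turns right cancellation by \<open>a\<close> into left cancellation by
  \<open>rev a\<close> over the opposite monoids. These are again regular, so the reverse of an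
  L*-idempotent for \<open>rev a\<close> is as required.\<close>

lemma ex_R_idempotent:
  assumes "a \<in> lists letters"
  obtains e where "e \<in> lists letters" "cls (e @ e) = cls e"
    "\<And>s t. s \<in> lists letters \<Longrightarrow> t \<in> lists letters \<Longrightarrow>
      cls (s @ a) = cls (t @ a) \<longleftrightarrow> cls (s @ e) = cls (t @ e)"
proof -
  interpret opp: graph_of_regular_monoids V E "\<lambda>\<alpha>. opposite (M \<alpha>)"
    by (rule graph_of_regular_monoids_opposite)
  have l: "opp.letters = letters"
    by (simp add: opp.letters_def letters_def)
  obtain e where e: "opp.L_idempotent (rev a) e"
    by (rule opp.ex_L_idempotent[of "rev a"]) (use assms in \<open>simp add: l in_lists_conv_set\<close>)
  then have el: "rev e \<in> lists letters" by (simp add: opp.L_idempotent_def l in_lists_conv_set)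
  show thesis
  proof (rule that[OF el])
    show "cls (rev e @ rev e) = cls (rev e)"
      using e cls_rev_iff[of "rev e @ rev e" "rev e"] el by (simp add: opp.L_idempotent_def)
    show "cls (s @ a) = cls (t @ a) \<longleftrightarrow> cls (s @ rev e) = cls (t @ rev e)"
      if st: "s \<in> lists letters" "t \<in> lists letters" for s t
    proof -
      have "rev s \<in> lists letters" "rev t \<in> lists letters" using st by auto
      then have "opp.cls (rev a @ rev s) = opp.cls (rev a @ rev t) \<longleftrightarrow>
          opp.cls (e @ rev s) = opp.cls (e @ rev t)"
        using e unfolding opp.L_idempotent_def l by blast
      then show ?thesis
        using cls_rev_iff[of "s @ a" "t @ a"] cls_rev_iff[of "s @ rev e" "t @ rev e"] st assms el
        by simp
    qed
  qed
qed

section \<open>The graph product as the monoid of classes of words\<close>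

lemma graph_product_eq: "graph_product V E M = quotient_monoid words C"
  by (simp add: graph_product_def letters_def Let_def)

lemma carrier_graph_product: "carrier (graph_product V E M) = cls ` lists letters"
  by (auto simp: graph_product_eq quotient_monoid_def quotient_def cls_def)

lemma mult_graph_product:
  "u \<in> lists letters \<Longrightarrow> w \<in> lists letters \<Longrightarrow> cls u \<otimes>\<^bsub>graph_product V E M\<^esub> cls w = cls (u @ w)"
  using quotient_monoid_mult[OF congruence_C, of u w] by (simp add: graph_product_eq cls_def)

theorem abundant_graph_product: "abundant_monoid (graph_product V E M)"
proof -
  interpret P: monoid "graph_product V E M"
    unfolding graph_product_eq by (intro monoid_quotient_monoid monoid_free_monoid congruence_C)
  show ?thesis
  proof unfold_locales
    fix A assume "A \<in> carrier (graph_product V E M)"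
    then obtain a where a: "A = cls a" "a \<in> lists letters" by (auto simp: carrier_graph_product)
    from a(2) obtain e where "L_idempotent a e" by (rule ex_L_idempotent)
    then have "cls e \<in> idempotents (graph_product V E M) \<and> (A, cls e) \<in> L_star (graph_product V E M)"
      using a by (auto simp: L_idempotent_def idempotents_def L_star_def carrier_graph_product
          mult_graph_product)
    then show "\<exists>e\<in>idempotents (graph_product V E M). (A, e) \<in> L_star (graph_product V E M)"
      by blast
    obtain e where "e \<in> lists letters" "cls (e @ e) = cls e"
      "\<And>s t. s \<in> lists letters \<Longrightarrow> t \<in> lists letters \<Longrightarrow>
        cls (s @ a) = cls (t @ a) \<longleftrightarrow> cls (s @ e) = cls (t @ e)"
      using ex_R_idempotent[OF a(2)] by metis
    then have "cls e \<in> idempotents (graph_product V E M) \<and> (A, cls e) \<in> R_star (graph_product V E M)"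
      using a by (auto simp: idempotents_def R_star_def carrier_graph_product
          mult_graph_product)
    then show "\<exists>e\<in>idempotents (graph_product V E M). (A, e) \<in> R_star (graph_product V E M)"
      by blast
  qed
qed

end

theorem corollary5p23:
  fixes V :: "'v set" and E :: "'v set set" and M :: "'v \<Rightarrow> ('a, 'm) monoid_scheme"
  assumes "simple_graph V E"
    and "\<And>\<alpha>. \<alpha> \<in> V \<Longrightarrow> regular_monoid (M \<alpha>)"
    and "disjoint_family_on (\<lambda>\<alpha>. carrier (M \<alpha>)) V"
  shows "abundant_monoid (graph_product V E M)"
proof -
  interpret graph_of_regular_monoids V E M
    using assms
    by (intro graph_of_regular_monoids.intro graph_of_monoids.intro
        graph_of_regular_monoids_axioms.intro)
      (simp_all add: simple_graph_def regular_monoid_def)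
  show ?thesis by (rule abundant_graph_product)
qed

end
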